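(* (1) If $B,C$ are semi-braces and $f:B\to C$ is a semi-brace homomorphism, then the associated affine structures $\sigma^B$ and $\sigma^C$ are homomorphic via $f$. (2) Conversely, if $\sigma,\varphi$ are affine structures on groups $G=(B,\circ)$ and $H=(C,\circ)$, respectively, and $f$ is a homomorphism between $\sigma$ and $\varphi$, then $f$ is a semi-brace homomorphism from $B_\sigma$ to $C_\varphi$.
   Context: For a group $(B,\circ)$, $0$ denotes its identity and $a^-$ the inverse of $a$. $B^B$ is the monoid (under composition) of all maps $B\to B$. For $\sigma:B\to B^B$ write $\sigma_a:=\sigma(a)$; juxtaposition of maps is composition. An affine structure on $(B,\circ)$ is a map $\sigma:B\to B^B$ that is a semigroup anti-homomorphism, i.e. $\sigma_{a\circ b}=\sigma_b\sigma_a$ for all $a,b\in B$ (it is not required that $\sigma_0=\mathrm{id}_B$), such that $\sigma_a(b\circ\sigma_b(c))=\sigma_a(b)\circ\sigma_{\sigma_a(b)}\sigma_a(c)$ for all $a,b,c\in B$. A (left) semi-brace is a set $B$ with two binary operations $+,\circ$ such that $(B,+)$ is a semigroup, $(B,\circ)$ is a group, and $a\circ(b+c)=a\circ b+a\circ(a^-+c)$ for all $a,b,c\in B$ ($\circ$ has higher precedence than $+$). A semi-brace homomorphism is a map preserving both operations. The affine structure associated to a semi-brace $B$ is $\sigma^B:B\to B^B$ with $\sigma^B_a(b)=a^-\circ(a+b)$. For an affine structure $\sigma$ on $(B,\circ)$, $B_\sigma$ denotes the semi-brace with multiplication $\circ$ and addition $a+b:=a\circ\sigma_a(b)$. If $\sigma,\varphi$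 are affine structures on groups $(B,\circ)$ and $(C,\circ)$, a homomorphism between $\sigma$ and $\varphi$ is a group homomorphism $f:(B,\circ)\to(C,\circ)$ such that $\varphi_{f(a)}f=f\sigma_a$ for every $a\in B$; in this case $\sigma$ and $\varphi$ are said to be homomorphic via $f$. *)

theory Defs
  imports "HOL-Algebra.Group"
begin

text \<open>
  Maps into \<open>B\<^sup>B\<close> are represented by curried HOL functions that are only constrained on the
  carrier; equality and composition of such maps are accordingly expressed pointwise on the carrier.
\<close>

record 'a semi_brace = "'a monoid" +
  sb_add :: "['a, 'a] \<Rightarrow> 'a" (infixl \<open>\<boxplus>\<index>\<close> 65)

locale semi_brace = group B for B (structure) +
  assumes sb_add_closed: "\<lbrakk>a \<in> carrier B; b \<in> carrier B\<rbrakk> \<Longrightarrow> a \<boxplus> b \<in> carrier B"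
    and sb_add_assoc: "\<lbrakk>a \<in> carrier B; b \<in> carrier B; c \<in> carrier B\<rbrakk>
      \<Longrightarrow> (a \<boxplus> b) \<boxplus> c = a \<boxplus> (b \<boxplus> c)"
    and sb_distrib: "\<lbrakk>a \<in> carrier B; b \<in> carrier B; c \<in> carrier B\<rbrakk>
      \<Longrightarrow> a \<otimes> (b \<boxplus> c) = a \<otimes> b \<boxplus> a \<otimes> (inv a \<boxplus> c)"

locale semi_brace_hom = B: semi_brace B + C: semi_brace C
  for B (structure) and C (structure) and f +
  assumes hom_mult: "f \<in> hom B C"
    and hom_add: "\<lbrakk>a \<in> carrier B; b \<in> carrier B\<rbrakk> \<Longrightarrow> f (a \<boxplus>\<^bsub>B\<^esub> b) = f a \<boxplus>\<^bsub>C\<^esub> f b"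

locale affine_structure = group G for G (structure) and \<sigma> :: "'a \<Rightarrow> 'a \<Rightarrow> 'a" +
  assumes map_closed: "a \<in> carrier G \<Longrightarrow> \<sigma> a \<in> carrier G \<rightarrow> carrier G"
    and anti_hom: "\<lbrakk>a \<in> carrier G; b \<in> carrier G; c \<in> carrier G\<rbrakk>
      \<Longrightarrow> \<sigma> (a \<otimes> b) c = \<sigma> b (\<sigma> a c)"
    and affine: "\<lbrakk>a \<in> carrier G; b \<in> carrier G; c \<in> carrier G\<rbrakk>
      \<Longrightarrow> \<sigma> a (b \<otimes> \<sigma> b c) = \<sigma> a b \<otimes> \<sigma> (\<sigma> a b) (\<sigma> a c)"

locale affine_structure_hom = G: affine_structure G \<sigma> + H: affine_structure H \<phi>
  for G (structure) and \<sigma> and H (structure) and \<phi> and f +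
  assumes hom_mult: "f \<in> hom G H"
    and intertwine: "\<lbrakk>a \<in> carrier G; b \<in> carrier G\<rbrakk> \<Longrightarrow> \<phi> (f a) (f b) = f (\<sigma> a b)"

definition assoc_affine :: "('a, 'm) semi_brace_scheme \<Rightarrow> 'a \<Rightarrow> 'a \<Rightarrow> 'a"
  where "assoc_affine B a b = inv\<^bsub>B\<^esub> a \<otimes>\<^bsub>B\<^esub> (a \<boxplus>\<^bsub>B\<^esub> b)"

definition semi_brace_of :: "('a, 'm) monoid_scheme \<Rightarrow> ('a \<Rightarrow> 'a \<Rightarrow> 'a) \<Rightarrow> 'a semi_brace"
  where "semi_brace_of G \<sigma> =
    \<lparr>carrier = carrier G, mult = mult G, one = one G, sb_add = (\<lambda>a b. a \<otimes>\<^bsub>G\<^esub> \<sigma> a b)\<rparr>"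

end

theory Submission
  imports Defs
begin

text \<open>Each operation determines the other over a fixed group: writing L_a for
  \<open>assoc_affine B a\<close>, a + b = a o L_a(b). At \<open>inv a\<close>, distributivity reads
  \<open>inv a\<close> o (b + c) = \<open>inv a\<close> o b + L_a(c) (\<open>inv_mult_add\<close>).
  This gives the anti-homomorphism law and, with associativity of +, the affine identity. Backwards,
  the affine law yields associativity and the anti-homomorphism law distributivity. Morphisms
  correspond because either structure is expressed by the other through the group operations, which
  f preserves.\<close>

lemma (in semi_brace) assoc_affine_closed:
  assumes "a \<in> carrier B" "b \<in> carrier B"
  shows "assoc_affine B a b \<in> carrier B"
  using assms by (simp add: assoc_affine_def sb_add_closed)

lemma (in semi_brace) mult_assoc_affine:
  assumes "a \<in> carrier B" "b \<in> carrier B"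
  shows "a \<otimes> assoc_affine B a b = a \<boxplus> b"
  using assms by (simp add: assoc_affine_def sb_add_closed m_assoc [symmetric])

lemma (in semi_brace) inv_mult_add:
  assumes "a \<in> carrier B" "b \<in> carrier B" "c \<in> carrier B"
  shows "inv a \<otimes> (b \<boxplus> c) = inv a \<otimes> b \<boxplus> assoc_affine B a c"
  using sb_distrib [of "inv a" b c] assms by (simp add: assoc_affine_def)

lemma (in semi_brace) affine_structure_assoc_affine:
  "affine_structure B (assoc_affine B)"
proof
  fix a assume "a \<in> carrier B"
  then show "assoc_affine B a \<in> carrier B \<rightarrow> carrier B"
    by (simp add: assoc_affine_closed)
next
  fix a b c assume abc: "a \<in> carrier B" "b \<in> carrier B" "c \<in> carrier B"
  have "assoc_affine B (a \<otimes> b) c = inv b \<otimes> (inv a \<otimes> (a \<otimes> b \<boxplus> c))"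
    using abc by (simp add: assoc_affine_def sb_add_closed inv_mult_group m_assoc)
  \<comment> \<open>Here \<open>inv_mult_add\<close> is applied with first summand a o b, from which
    a cancels.\<close>
  also have "inv a \<otimes> (a \<otimes> b \<boxplus> c) = b \<boxplus> assoc_affine B a c"
    using abc by (simp add: inv_mult_add m_assoc [symmetric])
  finally show "assoc_affine B (a \<otimes> b) c = assoc_affine B b (assoc_affine B a c)"
    by (simp add: assoc_affine_def)
next
  fix a b c assume abc: "a \<in> carrier B" "b \<in> carrier B" "c \<in> carrier B"
  \<comment> \<open>The inner argument is b + c; bracketing a + (b + c) to the left lets
    \<open>inv_mult_add\<close> split off c.\<close>
  have "assoc_affine B a (b \<otimes> assoc_affine B b c) = inv a \<otimes> ((a \<boxplus> b) \<boxplus> c)"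
    using abc by (simp add: mult_assoc_affine sb_add_assoc) (simp add: assoc_affine_def)
  also have "\<dots> = assoc_affine B a b \<boxplus> assoc_affine B a c"
    using inv_mult_add [of a "a \<boxplus> b" c] abc by (simp only: sb_add_closed assoc_affine_def)
  \<comment> \<open>The sum x + y with x = L_a(b) and y = L_a(c) is read as x o L_x(y).\<close>
  finally show "assoc_affine B a (b \<otimes> assoc_affine B b c) =
      assoc_affine B a b \<otimes> assoc_affine B (assoc_affine B a b) (assoc_affine B a c)"
    using abc by (simp add: mult_assoc_affine assoc_affine_closed)
qed

lemma (in semi_brace_hom) affine_structure_hom_assoc_affine:
  "affine_structure_hom B (assoc_affine B) C (assoc_affine C) f"
proof -
  interpret B': affine_structure B "assoc_affine B"
    by (rule B.affine_structure_assoc_affine)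
  interpret C': affine_structure C "assoc_affine C"
    by (rule C.affine_structure_assoc_affine)
  \<comment> \<open>Supplies f(\<open>inv a\<close>) = \<open>inv\<close> (f a), since
    \<open>assoc_affine\<close> involves an inverse.\<close>
  interpret group_hom B C f
    by unfold_locales (rule hom_mult)
  show ?thesis
  proof
    fix a b assume "a \<in> carrier B" "b \<in> carrier B"
    then show "assoc_affine C (f a) (f b) = f (assoc_affine B a b)"
      by (simp add: assoc_affine_def hom_add B.sb_add_closed)
  qed (rule semi_brace_hom.hom_mult [OF semi_brace_hom_axioms])
qed

lemma semi_brace_of_simps [simp]:
  "carrier (semi_brace_of G \<sigma>) = carrier G"
  "mult (semi_brace_of G \<sigma>) = mult G"
  "one (semi_brace_of G \<sigma>) = one G"
  "sb_add (semi_brace_of G \<sigma>) = (\<lambda>a b. a \<otimes>\<^bsub>G\<^esub> \<sigma> a b)"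
  by (simp_all add: semi_brace_of_def)

lemma inv_semi_brace_of [simp]: "m_inv (semi_brace_of G \<sigma>) = m_inv G"
  by (simp add: m_inv_def fun_eq_iff)

lemma (in affine_structure) map_mem:
  assumes "a \<in> carrier G" "b \<in> carrier G"
  shows "\<sigma> a b \<in> carrier G"
  using map_closed assms by blast

lemma (in affine_structure) semi_brace_semi_brace_of: "semi_brace (semi_brace_of G \<sigma>)"
proof -
  interpret S: group "semi_brace_of G \<sigma>"
    by (rule groupI) (auto simp: m_assoc intro: l_inv)
  show ?thesis
  proof (unfold_locales, simp_all only: semi_brace_of_simps inv_semi_brace_of)
    fix a b assume "a \<in> carrier G" "b \<in> carrier G"
    then show "a \<otimes> \<sigma> a b \<in> carrier G"
      by (simp add: map_mem)
  next
    fix a b c assume "a \<in> carrier G" "b \<in> carrier G" "c \<in> carrier G"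
    \<comment> \<open>By \<open>anti_hom\<close> the outer map on the left is \<sigma>_x \<sigma>_a
      with x = \<sigma>_a(b), so this is \<open>affine\<close> multiplied by a.\<close>
    then show "a \<otimes> \<sigma> a b \<otimes> \<sigma> (a \<otimes> \<sigma> a b) c = a \<otimes> \<sigma> a (b \<otimes> \<sigma> b c)"
      by (simp add: affine anti_hom map_mem m_assoc)
  next
    fix a b c assume abc: "a \<in> carrier G" "b \<in> carrier G" "c \<in> carrier G"
    \<comment> \<open>Distributivity reduces to \<sigma>_(a o b) \<sigma>_(\<open>inv a\<close>) =
      \<sigma>_b: the anti-homomorphism puts \<open>inv a\<close> to the left of a o b, where it
      cancels a.\<close>
    then have "a \<otimes> (inv a \<otimes> \<sigma> (inv a) c) = \<sigma> (inv a) c"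
      by (simp add: map_mem m_assoc [symmetric])
    moreover from abc have "\<sigma> (a \<otimes> b) (\<sigma> (inv a) c) = \<sigma> (inv a \<otimes> (a \<otimes> b)) c"
      by (simp only: anti_hom inv_closed m_closed)
    moreover from abc have "inv a \<otimes> (a \<otimes> b) = b"
      by (simp add: m_assoc [symmetric])
    ultimately show "a \<otimes> (b \<otimes> \<sigma> b c) =
        a \<otimes> b \<otimes> \<sigma> (a \<otimes> b) (a \<otimes> (inv a \<otimes> \<sigma> (inv a) c))"
      using abc by (simp add: map_mem m_assoc)
  qed
qed

lemma (in affine_structure_hom) semi_brace_hom_semi_brace_of:
  "semi_brace_hom (semi_brace_of G \<sigma>) (semi_brace_of H \<phi>) f"
proof (intro semi_brace_hom.intro semi_brace_hom_axioms.intro)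
  show "semi_brace (semi_brace_of G \<sigma>)"
    by (rule G.semi_brace_semi_brace_of)
  show "semi_brace (semi_brace_of H \<phi>)"
    by (rule H.semi_brace_semi_brace_of)
  show "f \<in> hom (semi_brace_of G \<sigma>) (semi_brace_of H \<phi>)"
    using hom_mult by (simp add: hom_def)
next
  fix a b assume "a \<in> carrier (semi_brace_of G \<sigma>)" "b \<in> carrier (semi_brace_of G \<sigma>)"
  then show "f (a \<boxplus>\<^bsub>semi_brace_of G \<sigma>\<^esub> b) = f a \<boxplus>\<^bsub>semi_brace_of H \<phi>\<^esub> f b"
    \<comment> \<open>f(a o \<sigma>_a(b)) = f(a) o f(\<sigma>_a(b)), and \<open>intertwine\<close>
      turns the last factor into \<phi>_(f a)(f b).\<close>
    using hom_mult by (simp add: intertwine hom_mult [THEN Group.hom_mult] G.map_mem)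
qed

theorem theorem12:
  fixes B :: "('a, 'm) semi_brace_scheme" and C :: "('b, 'n) semi_brace_scheme"
    and G :: "('c, 'p) monoid_scheme" and H :: "('d, 'q) monoid_scheme"
    and \<sigma> :: "'c \<Rightarrow> 'c \<Rightarrow> 'c" and \<phi> :: "'d \<Rightarrow> 'd \<Rightarrow> 'd"
    and f :: "'a \<Rightarrow> 'b" and g :: "'c \<Rightarrow> 'd"
  shows "(semi_brace B \<and> semi_brace C \<and> semi_brace_hom B C f \<longrightarrow>
            affine_structure_hom B (assoc_affine B) C (assoc_affine C) f)
       \<and> (affine_structure G \<sigma> \<and> affine_structure H \<phi> \<and> affine_structure_hom G \<sigma> H \<phi> g \<longrightarrow>
            semi_brace_hom (semi_brace_of G \<sigma>) (semi_brace_of H \<phi>) g)"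
  using semi_brace_hom.affine_structure_hom_assoc_affine
    affine_structure_hom.semi_brace_hom_semi_brace_of
  by blast

end
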